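(* Let $k\geq 1$ and let $M$ be a finite set of positive integers. There is a bijection $\xi:\mathcal{Q}_M(k)\to\mathcal{F}_M(k)$ such that $\mathrm{lap}(\pi)=\mathrm{lleaf}(\xi(\pi))$ for every $\pi\in\mathcal{Q}_M(k)$.
   Context: For $M=\{a_1<\dots<a_n\}$, $M_k$ denotes the multiset $\{a_1^k,\dots,a_n^k\}$ (each element repeated $k$ times). A Stirling permutation of a multiset is a word $\pi=\pi_1\pi_2\cdots$ using exactly the multiset's elements such that $\pi_i=\pi_l$ with $i<l$ implies $\pi_j\geq\pi_i$ for all $i<j<l$. $\mathcal{Q}_M(k)$ is the set of Stirling permutations of $M_k$. For $\pi=\pi_1\cdots\pi_{kn}$, an index $i$ is a longest ascent-plateau if $\pi_i<\pi_{i+1}=\pi_{i+2}=\cdots=\pi_{i+k}$. $\mathrm{lap}(\pi)$ is the number of longest ascent-plateaux of the word $0\pi$ (i.e. of $\pi$ with a $0$ prepended). Trees: all trees are ordered (plane) rooted trees; the level of a node is its distance from the root (root at level 0); a leaf is a node with no children. An even $k$-ary tree is an ordered tree in which every node on an even level has exactly $k$ children. A pruned even $k$-ary tree is obtained from an even $k$-ary tree by deleting, for every even-level node all of whose children are leaves, all those children. An increasing pruned even $k$-ary tree on $M$ is a pruned even $k$-ary tree whose nodes on even levels are labeled bijectively by $M$ (odd-level nodes are unlabeled) such that labels increase along every path from the root downward and, for each node, the labels of its children increase from left to right. An increasing pruned even $k$-ary forest on $M$ is a sequence $(T_1,\dots,T_m)$ of increasing pruned even $k$-ary trees whose label sets form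 a set partition of $M$ and whose root labels increase from left to right (the empty forest when $M=\emptyset$). $\mathcal{F}_M(k)$ is the set of such forests. A labeled leaf is a leaf on an even level; $\mathrm{lleaf}(F)$ is the total number of labeled leaves of $F$. *)

theory Defs
  imports "HOL-Library.Multiset" "HOL-Library.Disjoint_Sets"
begin

definition mult_copies :: "nat \<Rightarrow> nat set \<Rightarrow> nat multiset" where
  "mult_copies k M = repeat_mset k (mset_set M)"

definition stirling_perm :: "nat multiset \<Rightarrow> nat list \<Rightarrow> bool" where
  "stirling_perm A w \<longleftrightarrow> mset w = A \<and>
     (\<forall>i j l. i < j \<and> j < l \<and> l < length w \<and> w ! i = w ! l \<longrightarrow> w ! i \<le> w ! j)"

definition stirling_perms :: "nat set \<Rightarrow> nat \<Rightarrow> nat list set" where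
  "stirling_perms M k = {w. stirling_perm (mult_copies k M) w}"

definition longest_ascent_plateau :: "nat \<Rightarrow> nat list \<Rightarrow> nat \<Rightarrow> bool" where
  "longest_ascent_plateau k w i \<longleftrightarrow> i + k < length w \<and> w ! i < w ! (i + 1) \<and>
     (\<forall>j\<in>{1..k}. w ! (i + j) = w ! (i + 1))"

definition lap :: "nat \<Rightarrow> nat list \<Rightarrow> nat" where
  "lap k w = card {i. longest_ascent_plateau k (0 # w) i}"

datatype 'a otree = Node (root_label: 'a) (children: "'a otree list")

abbreviation is_leaf :: "'a otree \<Rightarrow> bool" where
  "is_leaf t \<equiv> children t = []"

text \<open>A node is represented by the subtree rooted at it. The list \<open>nodes l t\<close> enumerates all node
  occurrences of \<open>t\<close> together with their levels, the root of \<open>t\<close> being placed at level \<open>l\<close>.\<close>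

fun nodes :: "nat \<Rightarrow> 'a otree \<Rightarrow> (nat \<times> 'a otree) list" where
  "nodes l (Node a ts) = (l, Node a ts) # concat (map (nodes (Suc l)) ts)"

definition even_kary :: "nat \<Rightarrow> 'a otree \<Rightarrow> bool" where
  "even_kary k t \<longleftrightarrow> (\<forall>(l, s) \<in> set (nodes 0 t). even l \<longrightarrow> length (children s) = k)"

text \<open>The first argument of \<open>prune\<close> is the level of the root of the tree being pruned.\<close>

fun prune :: "nat \<Rightarrow> 'a otree \<Rightarrow> 'a otree" where
  "prune l (Node a ts) =
     Node a (if even l \<and> (\<forall>t\<in>set ts. is_leaf t) then [] else map (prune (Suc l)) ts)"

definition pruned_even_kary :: "nat \<Rightarrow> 'a otree \<Rightarrow> bool" where
  "pruned_even_kary k t \<longleftrightarrow> (\<exists>s. even_kary k s \<and> t = prune 0 s)"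

text \<open>Partially labeled trees carry labels of type \<^typ>\<open>nat option\<close>, where \<^term>\<open>None\<close> marks an
  unlabeled node. The underlying plane tree is obtained by forgetting labels, giving a
  \<^typ>\<open>unit otree\<close>.\<close>

abbreviation shape :: "'a otree \<Rightarrow> unit otree" where
  "shape \<equiv> map_otree (\<lambda>_. ())"

definition even_labels :: "nat option otree \<Rightarrow> nat option list" where
  "even_labels t = map (\<lambda>(l, s). root_label s) (filter (\<lambda>(l, s). even l) (nodes 0 t))"

definition label_set :: "nat option otree \<Rightarrow> nat set" where
  "label_set t = {a. Some a \<in> set_otree t}"

definition increasing_tree :: "nat \<Rightarrow> nat set \<Rightarrow> nat option otree \<Rightarrow> bool" where
  "increasing_tree k S t \<longleftrightarrow>
     pruned_even_kary k (shape t) \<and>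
     distinct (even_labels t) \<and> set (even_labels t) = Some ` S \<and>
     (\<forall>(l, s) \<in> set (nodes 0 t). odd l \<longrightarrow> root_label s = None) \<and>
     (\<forall>(l, s) \<in> set (nodes 0 t). \<forall>c \<in> set (children s). \<forall>a b.
        root_label s = Some a \<and> b \<in> label_set c \<longrightarrow> a < b) \<and>
     (\<forall>(l, s) \<in> set (nodes 0 t).
        sorted_wrt (<) (List.map_filter root_label (children s)))"

definition increasing_forests :: "nat set \<Rightarrow> nat \<Rightarrow> nat option otree list set" where
  "increasing_forests M k = {F.
     (\<forall>t \<in> set F. increasing_tree k (label_set t) t) \<and>
     distinct (map label_set F) \<and> partition_on M (set (map label_set F)) \<and>
     sorted_wrt (<) (map (\<lambda>t. the (root_label t)) F)}"

definition lleaf_tree :: "nat option otree \<Rightarrow> nat" where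
  "lleaf_tree t = length (filter (\<lambda>(l, s). even l \<and> is_leaf s) (nodes 0 t))"

definition lleaf :: "nat option otree list \<Rightarrow> nat" where
  "lleaf F = sum_list (map lleaf_tree F)"

end

theory Submission
  imports Defs "HOL-Library.Sublist"
begin

text \<open>
  Read off a word from a forest by sending a tree with root \<open>r\<close>, whose odd-level nodes carry the
  forests \<open>F\<^sub>1, \<dots>, F\<^sub>k\<close>, to \<open>w(F\<^sub>1) r w(F\<^sub>2) r \<dots> w(F\<^sub>k) r\<close>, and concatenating over the trees of the
  forest. A labeled leaf stands for \<open>k\<close> empty forests. Conversely, the \<open>k\<close> copies of the minimum \<open>r\<close>
  cut a Stirling permutation into \<open>k + 1\<close> Stirling permutations on disjoint label sets; the first
  \<open>k\<close> give the subtrees below \<open>r\<close> and the last one gives the remaining trees. The copies of \<open>r\<close> form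
  a longest ascent-plateau iff the pieces before the last copy are all empty, that is, iff \<open>r\<close>
  labels a leaf: a nonempty first piece would end in a letter larger than \<open>r\<close>.
\<close>

section \<open>Stirling words\<close>

text \<open>Pattern form of the Stirling condition: no letter encloses a smaller one. Phrased with
  \<open>subseq\<close>, it can be split along appended words without index arithmetic.\<close>

definition stirling_word :: "nat list \<Rightarrow> bool" where
  "stirling_word w \<longleftrightarrow> (\<forall>a b. b < a \<longrightarrow> \<not> subseq [a, b, a] w)"

lemma subseq_triple_iff_nth:
  "subseq [a, b, c] w \<longleftrightarrow>
    (\<exists>i j l. i < j \<and> j < l \<and> l < length w \<and> w ! i = a \<and> w ! j = b \<and> w ! l = c)"
proof
  assume "subseq [a, b, c] w"
  then obtain p w' where w': "w = p @ a # w'" "subseq [b, c] w'"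
    by (blast dest: list_emb_ConsD)
  then obtain q w'' where w'': "w' = q @ b # w''" "subseq [c] w''"
    by (blast dest: list_emb_ConsD)
  then obtain s t where "w'' = s @ c # t"
    by (blast dest: list_emb_ConsD)
  with w' w'' have "w = p @ a # q @ b # s @ c # t" by simp
  then have "w ! length p = a" "w ! (length p + 1 + length q) = b"
    "w ! (length p + 1 + length q + 1 + length s) = c"
    "length p + 1 + length q + 1 + length s < length w"
    by (simp_all add: nth_append nth_Cons')
  then show "\<exists>i j l. i < j \<and> j < l \<and> l < length w \<and> w ! i = a \<and> w ! j = b \<and> w ! l = c"
    by (intro exI[of _ "length p"] exI[of _ "length p + 1 + length q"]
        exI[of _ "length p + 1 + length q + 1 + length s"]) simp
next
  assume "\<exists>i j l. i < j \<and> j < l \<and> l < length w \<and> w ! i = a \<and> w ! j = b \<and> w ! l = c"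
  then obtain i j l where *: "i < j" "j < l" "l < length w" "w ! i = a" "w ! j = b" "w ! l = c"
    by blast
  \<comment> \<open>The word is cut after positions \<open>i\<close> and \<open>j\<close>, so that
    each piece holds one letter of the pattern.\<close>
  have "subseq ([a] @ [b] @ [c]) (take (Suc i) w @ take (j - i) (drop (Suc i) w) @ drop (Suc j) w)"
  proof (intro list_emb_append_mono)
    show "subseq [a] (take (Suc i) w)"
      using * by (force simp: subseq_singleton_left in_set_conv_nth)
    show "subseq [b] (take (j - i) (drop (Suc i) w))"
      using * by (force simp: subseq_singleton_left in_set_conv_nth intro!: exI[of _ "j - Suc i"])
    show "subseq [c] (drop (Suc j) w)"
      using * by (force simp: subseq_singleton_left in_set_conv_nth intro!: exI[of _ "l - Suc j"])
  qed
  moreover have "take (Suc i) w @ take (j - i) (drop (Suc i) w) @ drop (Suc j) w = w"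
    using * take_add[of "Suc i" "j - i" w] append_take_drop_id[of "Suc j" w]
    by (simp flip: append_assoc)
  ultimately show "subseq [a, b, c] w" by simp
qed

lemma stirling_perm_iff: "stirling_perm A w \<longleftrightarrow> mset w = A \<and> stirling_word w"
proof -
  have "w ! i \<le> w ! j"
    if "stirling_word w" "i < j" "j < l" "l < length w" "w ! i = w ! l" for i j l
  proof (rule ccontr)
    assume "\<not> w ! i \<le> w ! j"
    moreover have "subseq [w ! i, w ! j, w ! i] w"
      unfolding subseq_triple_iff_nth using that(2-5) by (intro exI[of _ i] exI[of _ j] exI[of _ l]) simp
    ultimately show False using that(1) by (simp add: stirling_word_def)
  qed
  moreover have "stirling_word w"
    if *: "\<And>i j l. i < j \<Longrightarrow> j < l \<Longrightarrow> l < length w \<Longrightarrow> w ! i = w ! l \<Longrightarrow> w ! i \<le> w ! j"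
    unfolding stirling_word_def subseq_triple_iff_nth
  proof (intro allI impI notI, elim exE conjE)
    fix a b i j l
    assume "b < a" "i < j" "j < l" "l < length w" "w ! i = a" "w ! j = b" "w ! l = a"
    with *[of i j l] show False by simp
  qed
  ultimately show ?thesis unfolding stirling_perm_def by blast
qed

text \<open>Separates the multiset condition into a uniform multiplicity, which the pieces of a cut
  inherit, and the set of letters. As \<open>k\<close> is positive, every element of
  \<open>M\<close> really occurs.\<close>

lemma stirling_perms_iff:
  assumes "k \<ge> 1" "finite M"
  shows "w \<in> stirling_perms M k \<longleftrightarrow>
    stirling_word w \<and> (\<forall>x\<in>set w. count (mset w) x = k) \<and> set w = M"
proof -
  have "mset w = mult_copies k M \<longleftrightarrow> (\<forall>x\<in>set w. count (mset w) x = k) \<and> set w = M" (is "?L \<longleftrightarrow> ?R")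
  proof
    assume L: ?L
    then have c: "count (mset w) x = (if x \<in> M then k else 0)" for x
      using assms by (simp add: mult_copies_def count_mset_set')
    have "set w = M"
    proof (rule set_eqI)
      fix x show "x \<in> set w \<longleftrightarrow> x \<in> M"
        using c[of x] assms(1) by (metis count_mset_0_iff not_one_le_zero)
    qed
    then show ?R using c by simp
  next
    assume ?R
    then show ?L
      using assms by (auto simp: mult_copies_def count_mset_set' intro!: multiset_eqI)
  qed
  then show ?thesis by (auto simp: stirling_perms_def stirling_perm_iff)
qed

lemma count_mset_notin: "x \<notin> set w \<Longrightarrow> count (mset w) x = 0"
  by simp

text \<open>A letter \<open>a\<close> on both sides of \<open>r\<close> would give the forbidden
  pattern \<open>[a, r, a]\<close>, because every letter of \<open>u\<close> exceeds
  \<open>r\<close>.\<close>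

lemma stirling_word_appendD:
  assumes "stirling_word (u @ r # v)" "\<forall>x\<in>set u. r < x"
  shows "stirling_word u" "stirling_word v" "set u \<inter> set v = {}"
proof -
  show "stirling_word u" "stirling_word v"
    using assms(1) unfolding stirling_word_def
    by (meson list_emb_append2 list_emb_Cons subseq_rev_drop_many)+
  show "set u \<inter> set v = {}"
  proof (rule ccontr)
    assume "set u \<inter> set v \<noteq> {}"
    then obtain a where "a \<in> set u" "a \<in> set v" by blast
    then have "subseq ([a] @ [r, a]) (u @ r # v)"
      by (intro list_emb_append_mono) (auto simp: subseq_singleton_left)
    then show False using assms \<open>a \<in> set u\<close> by (auto simp: stirling_word_def)
  qed
qed

lemma subseq_set_subset: "subseq u v \<Longrightarrow> set u \<subseteq> set v"
  by (auto elim: list_emb_set)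

lemma stirling_word_appendI:
  assumes "stirling_word u" "stirling_word v" "set u \<inter> set v = {}"
    and "\<forall>x\<in>set u. r < x" "\<forall>x\<in>set v. r \<le> x"
  shows "stirling_word (u @ r # v)"
  unfolding stirling_word_def
proof (intro allI impI notI)
  fix a b assume "b < a" and s: "subseq [a, b, a] (u @ r # v)"
  have "set [a, b, a] \<subseteq> set (u @ r # v)" using s by (metis subseq_set_subset)
  then have "r < a" using \<open>b < a\<close> assms(4,5) by fastforce
  from s obtain xs ys where xy: "[a, b, a] = xs @ ys" "subseq xs u" "subseq ys (r # v)"
    by (auto simp: subseq_append_iff)
  have sub: "set xs \<subseteq> set u" "set ys \<subseteq> insert r (set v)"
    using xy subseq_set_subset by fastforce+
  \<comment> \<open>Unless one part of the pattern is empty, the cut leaves a copy of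
    \<open>a\<close> on each side.\<close>
  consider "xs = []" | "ys = []" | "a \<in> set xs" "a \<in> set ys"
    using xy(1) by (auto simp: Cons_eq_append_conv)
  then show False
  proof cases
    case 1
    then have "subseq [a, b, a] (r # v)" using xy by simp
    then have "subseq [a, b, a] v" using \<open>r < a\<close> by simp
    then show False using assms(2) \<open>b < a\<close> by (auto simp: stirling_word_def)
  next
    case 2
    then show False using xy assms(1) \<open>b < a\<close> by (auto simp: stirling_word_def)
  next
    case 3
    then show False using sub assms(3) \<open>r < a\<close> by auto
  qed
qed

section \<open>Cutting a word at the copies of a letter\<close>

fun interleave :: "nat \<Rightarrow> nat list list \<Rightarrow> nat list \<Rightarrow> nat list" where
  "interleave r [] v = v"
| "interleave r (u # us) v = u @ r # interleave r us v"

lemma interleave_conv_concat: "interleave r us v = concat (map (\<lambda>u. u @ [r]) us) @ v"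
  by (induction us) auto

lemma length_interleave_less:
  "us \<noteq> [] \<Longrightarrow> u \<in> set (v # us) \<Longrightarrow> length u < length (interleave r us v)"
proof (induction us)
  case (Cons u' us)
  then show ?case by (cases "us = []") auto
qed simp

text \<open>No piece contains \<open>r\<close>, so the first copy of \<open>r\<close> marks the end
  of the first piece. The common number of pieces determines where the tails \<open>v\<close> and
  \<open>v'\<close> begin.\<close>

lemma interleave_inject:
  assumes "length us = length us'" "interleave r us v = interleave r us' v'"
    and "\<forall>u\<in>set us. r \<notin> set u" "\<forall>u\<in>set us'. r \<notin> set u"
  shows "us = us' \<and> v = v'"
  using assms
proof (induction us us' rule: list_induct2)
  case (Cons u us u' us')
  then have "u = u' \<and> interleave r us v = interleave r us' v'"
    by (auto simp: append_eq_append_conv2 Cons_eq_append_conv append_eq_Cons_conv)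
  then show ?case using Cons by auto
qed simp

lemma interleave_split:
  "count (mset w) r = k \<Longrightarrow>
    \<exists>us v. length us = k \<and> w = interleave r us v \<and> (\<forall>u\<in>set (v # us). r \<notin> set u)"
proof (induction k arbitrary: w)
  case 0
  then show ?case by (auto intro!: exI[of _ "[]"])
next
  case (Suc k)
  then have "r \<in> set w" by (metis count_mset_0_iff nat.distinct(1))
  then obtain u w' where w: "w = u @ r # w'" "r \<notin> set u" by (metis split_list_first)
  with Suc.prems have "count (mset w') r = k" by (simp add: count_mset_notin)
  from Suc.IH[OF this] obtain us v where "length us = k" "w' = interleave r us v"
    "\<forall>u\<in>set (v # us). r \<notin> set u" by blast
  with w show ?case by (auto intro!: exI[of _ "u # us"] exI[of _ v])
qed

text \<open>By \<open>stirling_word_appendD\<close> the pieces share no letters, so all copies of a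
  letter other than \<open>r\<close> lie in a single piece. The count hypothesis exempts
  \<open>r\<close>, which loses one copy with each piece that the induction strips off.\<close>

lemma stirling_word_interleaveD:
  assumes "stirling_word (interleave r us v)" "\<forall>u\<in>set (v # us). \<forall>x\<in>set u. r < x"
    and "\<forall>x\<in>set (interleave r us v). x \<noteq> r \<longrightarrow> count (mset (interleave r us v)) x = k"
  shows "\<forall>u\<in>set (v # us). stirling_word u \<and> (\<forall>x\<in>set u. count (mset u) x = k)"
  using assms
proof (induction us)
  case Nil
  then show ?case by auto
next
  case (Cons u us)
  let ?V = "interleave r us v"
  have s: "stirling_word u" "stirling_word ?V" "set u \<inter> set ?V = {}"
    using stirling_word_appendD[of u r ?V] Cons.prems(1,2) by auto
  have "count (mset ?V) x = k" if "x \<in> set ?V" "x \<noteq> r" for x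
  proof -
    have "count (mset u) x = 0" using that s(3) by (auto simp: count_mset_notin)
    then show ?thesis using bspec[OF Cons.prems(3), of x] that by (simp add: count_mset_notin)
  qed
  moreover have "count (mset u) x = k" if "x \<in> set u" for x
  proof -
    have "count (mset ?V) x = 0" "x \<noteq> r"
      using that s(3) Cons.prems(2) by (auto simp: count_mset_notin disjoint_iff)
    then show ?thesis using bspec[OF Cons.prems(3), of x] that by (simp add: count_mset_notin)
  qed
  ultimately show ?case using Cons s by simp
qed

section \<open>Counting longest ascent-plateaux\<close>

text \<open>Here \<open>p\<close> is the letter before the word, so that ascents can be tested by
  recursion on the word. The comparison with \<open>replicate\<close> also demands that
  \<open>k\<close> letters remain.\<close>

fun lap_after :: "nat \<Rightarrow> nat \<Rightarrow> nat list \<Rightarrow> nat" where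
  "lap_after k p [] = 0"
| "lap_after k p (x # w) =
    of_bool (p < x \<and> take k (x # w) = replicate k x) + lap_after k x w"

text \<open>Index 0 is the test made at the first letter, and the other indices are those of the
  shorter word shifted by one. Finiteness is carried along for the cardinality of the union.\<close>

lemma card_longest_ascent_plateau:
  assumes "k \<ge> 1"
  shows "finite {i. longest_ascent_plateau k (p # w) i} \<and>
    card {i. longest_ascent_plateau k (p # w) i} = lap_after k p w"
proof (induction w arbitrary: p)
  case Nil
  then show ?case using assms by (simp add: longest_ascent_plateau_def)
next
  case (Cons x w)
  let ?A = "{i. longest_ascent_plateau k (x # w) i}"
  let ?P = "p < x \<and> take k (x # w) = replicate k x"
  have zero: "longest_ascent_plateau k (p # x # w) 0 \<longleftrightarrow> ?P"
  proof -
    have "take k (x # w) = replicate k x \<longleftrightarrow> k \<le> length (x # w) \<and> (\<forall>i<k. (x # w) ! i = x)"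
      by (auto simp: list_eq_iff_nth_eq min_def)
    moreover have "(\<forall>j\<in>{1..k}. (p # x # w) ! (0 + j) = (p # x # w) ! (0 + 1)) \<longleftrightarrow>
        (\<forall>i<k. (x # w) ! i = x)"
    proof -
      have "{1..k} = Suc ` {..<k}" by (simp add: image_Suc_lessThan)
      then show ?thesis by auto
    qed
    ultimately show ?thesis unfolding longest_ascent_plateau_def by auto
  qed
  have suc: "longest_ascent_plateau k (p # x # w) (Suc i) \<longleftrightarrow> longest_ascent_plateau k (x # w) i" for i
    by (simp add: longest_ascent_plateau_def)
  have "{i. longest_ascent_plateau k (p # x # w) i} = (if ?P then {0} else {}) \<union> Suc ` ?A"
    (is "?L = ?R")
  proof (rule set_eqI)
    fix i show "i \<in> ?L \<longleftrightarrow> i \<in> ?R"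
      using zero suc by (cases i) auto
  qed
  then show ?case using Cons[of x] by (auto simp: card_image)
qed

lemma lap_conv_lap_after: "k \<ge> 1 \<Longrightarrow> lap k w = lap_after k 0 w"
  by (simp add: lap_def card_longest_ascent_plateau)

lemma lap_after_cong:
  "\<forall>x\<in>set w. p < x \<and> q < x \<Longrightarrow> lap_after k p w = lap_after k q w"
  by (cases w) auto

text \<open>A run of \<open>x\<close> cannot pass over the different letter \<open>r\<close>, so a
  full plateau fits into \<open>u\<close>.\<close>

lemma take_append_Cons_eq_replicate:
  "x \<noteq> r \<Longrightarrow> take k (u @ r # v) = replicate k x \<longleftrightarrow> take k u = replicate k x"
proof (induction u arbitrary: k)
  case Nil
  then show ?case by (cases k) auto
next
  case (Cons y u)
  then show ?case by (cases k) auto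
qed

text \<open>Plateaux that start in \<open>u\<close> end before \<open>r\<close>. The letter
  preceding \<open>r\<close> is \<open>last (p # u)\<close>, which is \<open>p\<close> itself if
  \<open>u\<close> is empty.\<close>

lemma lap_after_append_Cons:
  assumes "r \<notin> set u"
  shows "lap_after k p (u @ r # v) = lap_after k p u + lap_after k (last (p # u)) (r # v)"
  using assms
proof (induction u arbitrary: p)
  case (Cons x u)
  have "take k (x # u @ r # v) = replicate k x \<longleftrightarrow> take k (x # u) = replicate k x"
    using take_append_Cons_eq_replicate[of x r k "x # u" v] Cons.prems by auto
  then show ?case using Cons by (simp del: take_Cons)
qed simp

text \<open>Each copy of \<open>r\<close> at a cut is preceded by \<open>r\<close> or by a larger
  letter, so no ascent leads to it.\<close>

lemma lap_after_interleave_self: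
  assumes "\<forall>u\<in>set us. \<forall>x\<in>set u. r < x"
  shows "lap_after k r (interleave r us v) = (\<Sum>u\<leftarrow>us. lap_after k r u) + lap_after k r v"
  using assms
proof (induction us)
  case (Cons u us)
  have "r \<notin> set u" using Cons.prems by auto
  moreover have "\<not> last (r # u) < r" using Cons.prems by (auto dest: last_in_set less_asym)
  ultimately show ?case using Cons by (simp add: lap_after_append_Cons)
qed simp

lemma take_interleave_eq_replicate:
  assumes "\<forall>u\<in>set us. r \<notin> set u"
  shows "take (length us) (interleave r us v) = replicate (length us) r \<longleftrightarrow> (\<forall>u\<in>set us. u = [])"
  using assms
proof (induction us)
  case (Cons u us)
  then show ?case by (cases u) auto
qed simp

text \<open>Only the first copy of \<open>r\<close> can be reached by an ascent, and only if the
  first piece is empty. The plateau then has full length iff the other pieces are empty as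
  well.\<close>

lemma lap_after_interleave:
  assumes "us \<noteq> []" "p < r" "\<forall>u\<in>set us. \<forall>x\<in>set u. r < x"
  shows "lap_after (length us) p (interleave r us v) =
    of_bool (\<forall>u\<in>set us. u = []) + (\<Sum>u\<leftarrow>us. lap_after (length us) r u) + lap_after (length us) r v"
proof -
  obtain u us' where us: "us = u # us'" using assms(1) by (cases us) auto
  let ?k = "length us"
  have nr: "\<forall>u\<in>set us. r \<notin> set u" using assms(3) by auto
  have "lap_after ?k p (interleave r us v) =
      lap_after ?k p u + lap_after ?k (last (p # u)) (r # interleave r us' v)"
    using nr by (simp add: us lap_after_append_Cons del: lap_after.simps)
  also have "lap_after ?k p u = lap_after ?k r u"
    using assms us by (intro lap_after_cong) auto
  also have "lap_after ?k (last (p # u)) (r # interleave r us' v) =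
      of_bool (\<forall>u\<in>set us. u = []) + lap_after ?k r (interleave r us' v)"
  proof (cases "u = []")
    case True
    then show ?thesis
      using take_interleave_eq_replicate[OF nr, of v] assms(2) by (simp add: us)
  next
    case False
    \<comment> \<open>A nonempty \<open>u\<close> ends in a letter above \<open>r\<close>, so no
      ascent leads to \<open>r\<close>; the \<open>of_bool\<close> term is 0 as well.\<close>
    then have "\<not> last (p # u) < r" using assms(3) us by (auto dest: last_in_set less_asym)
    then show ?thesis using False by (simp add: us)
  qed
  also have "lap_after ?k r (interleave r us' v) =
      (\<Sum>u\<leftarrow>us'. lap_after ?k r u) + lap_after ?k r v"
    using assms(3) us by (intro lap_after_interleave_self) auto
  finally show ?thesis by (simp add: us)
qed

section \<open>Local description of increasing forests\<close>

text \<open>Gathers all requirements on one node of level \<open>l\<close>, so that the condition on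
  a tree decomposes along its recursion.\<close>

definition node_ok :: "nat \<Rightarrow> nat \<Rightarrow> nat option otree \<Rightarrow> bool" where
  "node_ok k l s \<longleftrightarrow>
    (even l \<longrightarrow> root_label s \<noteq> None \<and>
      (is_leaf s \<or> length (children s) = k \<and> (\<exists>c\<in>set (children s). \<not> is_leaf c))) \<and>
    (odd l \<longrightarrow> root_label s = None) \<and>
    (\<forall>c\<in>set (children s). \<forall>a b. root_label s = Some a \<and> b \<in> label_set c \<longrightarrow> a < b) \<and>
    sorted_wrt (<) (List.map_filter root_label (children s))"

definition all_nodes_ok :: "nat \<Rightarrow> nat \<Rightarrow> nat option otree \<Rightarrow> bool" where
  "all_nodes_ok k l t \<longleftrightarrow> (\<forall>(m, s)\<in>set (nodes l t). node_ok k m s)"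

lemma all_nodes_ok_Node:
  "all_nodes_ok k l (Node x ts) \<longleftrightarrow> node_ok k l (Node x ts) \<and> (\<forall>t\<in>set ts. all_nodes_ok k (Suc l) t)"
  by (auto simp: all_nodes_ok_def)

lemma nodes_Suc_Suc: "nodes (Suc (Suc l)) t = map (map_prod (Suc \<circ> Suc) id) (nodes l t)"
proof (induction t arbitrary: l)
  case (Node x ts)
  then show ?case by (auto simp: map_concat intro!: arg_cong[where f = concat])
qed

text \<open>Only the parity of the level matters, so a subtree two levels down is judged like a tree
  in its own right.\<close>

lemma all_nodes_ok_Suc_Suc: "all_nodes_ok k (Suc (Suc l)) t \<longleftrightarrow> all_nodes_ok k l t"
proof (induction t arbitrary: l)
  case (Node x ts)
  then show ?case by (auto simp: all_nodes_ok_Node node_ok_def)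
qed

fun labels :: "nat option otree \<Rightarrow> nat list" where
  "labels (Node x ts) = (case x of None \<Rightarrow> [] | Some a \<Rightarrow> [a]) @ concat (map labels ts)"

lemma label_set_conv_labels: "label_set t = set (labels t)"
proof (induction t)
  case (Node x ts)
  then show ?case by (auto simp: label_set_def split: option.splits)
qed

lemma even_labels_conv_labels:
  assumes "\<forall>(l, s)\<in>set (nodes 0 t). even l \<longleftrightarrow> root_label s \<noteq> None"
  shows "even_labels t = map Some (labels t)"
proof -
  have "map (\<lambda>(l, s). root_label s) (filter (\<lambda>(l, s). even l) (nodes l t)) = map Some (labels t)"
    if "\<forall>(l, s)\<in>set (nodes l t). even l \<longleftrightarrow> root_label s \<noteq> None" for l
    using that
  proof (induction t arbitrary: l)
    case (Node x ts)
    have "concat (map (\<lambda>t. map (\<lambda>(l, s). root_label s)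
        (filter (\<lambda>(l, s). even l) (nodes (Suc l) t))) ts) = concat (map (\<lambda>t. map Some (labels t)) ts)"
      using Node by (intro arg_cong[where f = concat] map_cong) auto
    then show ?case
      using Node.prems by (auto simp: filter_concat map_concat comp_def split: option.splits)
  qed
  from this[OF assms] show ?thesis by (simp add: even_labels_def)
qed

section \<open>Undoing the pruning\<close>

lemma nodes_map_otree: "nodes l (map_otree f t) = map (map_prod id (map_otree f)) (nodes l t)"
proof (induction t arbitrary: l)
  case (Node x ts)
  then show ?case by (auto simp: map_concat intro!: arg_cong[where f = concat])
qed

text \<open>Gives every even-level leaf its \<open>k\<close> leaf children back. Their label
  \<open>a\<close> is a placeholder, because pruning deletes them again.\<close>

fun unprune :: "nat \<Rightarrow> nat \<Rightarrow> 'a otree \<Rightarrow> 'a otree" where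
  "unprune k l (Node a ts) =
    Node a (if even l \<and> ts = [] then replicate k (Node a []) else map (unprune k (Suc l)) ts)"

text \<open>Emptiness of a child list changes at even levels only, so the test whether all children
  of an even-level node are leaves has the same outcome before and after.\<close>

lemma is_leaf_unprune_odd: "odd l \<Longrightarrow> is_leaf (unprune k l t) \<longleftrightarrow> is_leaf t"
  by (cases t) auto

lemma is_leaf_prune_odd: "odd l \<Longrightarrow> is_leaf (prune l t) \<longleftrightarrow> is_leaf t"
  by (cases t) auto

text \<open>Replaces the existential over even k-ary trees by a condition at each node;
  \<open>unprune\<close> provides the witness.\<close>

lemma pruned_even_kary_iff:
  "pruned_even_kary k t \<longleftrightarrow> (\<forall>(l, s)\<in>set (nodes 0 t). even l \<longrightarrow>
    is_leaf s \<or> length (children s) = k \<and> (\<exists>c\<in>set (children s). \<not> is_leaf c))"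
proof -
  let ?Q = "\<lambda>(l::nat, s::'a otree). even l \<longrightarrow>
    is_leaf s \<or> length (children s) = k \<and> (\<exists>c\<in>set (children s). \<not> is_leaf c)"
  let ?E = "\<lambda>(l::nat, s::'a otree). even l \<longrightarrow> length (children s) = k"
  have prune: "\<forall>n\<in>set (nodes l (prune l s)). ?Q n" if "\<forall>n\<in>set (nodes l s). ?E n" for l s
    using that
  proof (induction s arbitrary: l)
    case (Node a ts)
    have IH: "\<forall>n\<in>set (nodes (Suc l) (prune (Suc l) t)). ?Q n" if "t \<in> set ts" for t
      using Node.prems that by (intro Node.IH) auto
    show ?case
    proof (cases "even l \<and> (\<forall>t\<in>set ts. is_leaf t)")
      case True
      then show ?thesis by simp
    next
      case False
      then have "?Q (l, Node a (map (prune (Suc l)) ts))"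
        using Node.prems by (auto simp: is_leaf_prune_odd)
      moreover have "prune l (Node a ts) = Node a (map (prune (Suc l)) ts)"
        using False by auto
      ultimately show ?thesis using IH by (simp add: split_beta)
    qed
  qed
  have unprune: "prune l (unprune k l s) = s \<and> (\<forall>n\<in>set (nodes l (unprune k l s)). ?E n)"
    if "\<forall>n\<in>set (nodes l s). ?Q n" for l s
    using that
  proof (induction s arbitrary: l)
    case (Node a ts)
    have IH: "prune (Suc l) (unprune k (Suc l) t) = t \<and>
        (\<forall>n\<in>set (nodes (Suc l) (unprune k (Suc l) t)). ?E n)" if "t \<in> set ts" for t
      using Node.prems that by (intro Node.IH) auto
    have Q: "?Q (l, Node a ts)" using Node.prems by simp
    show ?case
    proof (cases "even l \<and> ts = []")
      case True
      then show ?thesis by auto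
    next
      case False
      \<comment> \<open>At an even level \<open>?Q\<close> supplies a child that is not a leaf, so
        pruning keeps the children of this node.\<close>
      have "\<not> (even l \<and> (\<forall>t\<in>set (map (unprune k (Suc l)) ts). is_leaf t))"
        using False Q by (auto simp: is_leaf_unprune_odd)
      then have "prune l (unprune k l (Node a ts)) = Node a ts"
        using False IH by (simp add: map_idI) blast
      moreover have "\<forall>n\<in>set (nodes l (unprune k l (Node a ts))). ?E n"
        using False IH Q by (simp add: split_beta)
      ultimately show ?thesis by blast
    qed
  qed
  show ?thesis
  proof
    assume "pruned_even_kary k t"
    then obtain s where "\<forall>n\<in>set (nodes 0 s). ?E n" "t = prune 0 s"
      unfolding pruned_even_kary_def even_kary_def by blast
    then show "\<forall>n\<in>set (nodes 0 t). ?Q n" using prune[of 0 s] by (simp only:)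
  next
    assume "\<forall>n\<in>set (nodes 0 t). ?Q n"
    from unprune[OF this] show "pruned_even_kary k t"
      unfolding pruned_even_kary_def even_kary_def by (intro exI[of _ "unprune k 0 t"]) simp
  qed
qed

lemma increasing_tree_iff:
  "increasing_tree k (label_set t) t \<longleftrightarrow> all_nodes_ok k 0 t \<and> distinct (labels t)"
proof -
  \<comment> \<open>The labeled nodes are exactly those on even levels. Both sides of the
    equivalence imply this, and under it \<open>even_labels\<close> and \<open>labels\<close> agree
    up to \<open>Some\<close>.\<close>
  let ?par = "\<forall>(l, s)\<in>set (nodes 0 t). even l \<longleftrightarrow> root_label s \<noteq> None"
  have leaf: "is_leaf (shape s) \<longleftrightarrow> is_leaf s" "length (children (shape s)) = length (children s)"
    "(\<exists>c\<in>set (children (shape s)). \<not> is_leaf c) \<longleftrightarrow> (\<exists>c\<in>set (children s). \<not> is_leaf c)"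
    for s :: "nat option otree"
    by (cases s; force simp: otree.map_sel)+
  have shape: "pruned_even_kary k (shape t) \<longleftrightarrow> (\<forall>(l, s)\<in>set (nodes 0 t). even l \<longrightarrow>
      is_leaf s \<or> length (children s) = k \<and> (\<exists>c\<in>set (children s). \<not> is_leaf c))"
    unfolding pruned_even_kary_iff nodes_map_otree
    by (auto simp: leaf split_beta)
  have "?par" if "increasing_tree k (label_set t) t"
  proof -
    have "root_label s \<noteq> None" if "(l, s) \<in> set (nodes 0 t)" "even l" for l s
    proof -
      have "root_label s \<in> set (even_labels t)" using that by (force simp: even_labels_def)
      then show ?thesis using \<open>increasing_tree k (label_set t) t\<close> by (auto simp: increasing_tree_def)
    qed
    then show ?thesis using that by (auto simp: increasing_tree_def)
  qed
  moreover have "?par" if "all_nodes_ok k 0 t"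
    using that by (auto simp: all_nodes_ok_def node_ok_def)
  moreover have "increasing_tree k (label_set t) t \<longleftrightarrow> all_nodes_ok k 0 t \<and> distinct (labels t)" if ?par
  proof -
    have "all_nodes_ok k 0 t \<longleftrightarrow>
      (\<forall>(l, s)\<in>set (nodes 0 t). even l \<longrightarrow>
        is_leaf s \<or> length (children s) = k \<and> (\<exists>c\<in>set (children s). \<not> is_leaf c)) \<and>
      (\<forall>(l, s)\<in>set (nodes 0 t). odd l \<longrightarrow> root_label s = None) \<and>
      (\<forall>(l, s)\<in>set (nodes 0 t). \<forall>c\<in>set (children s). \<forall>a b.
        root_label s = Some a \<and> b \<in> label_set c \<longrightarrow> a < b) \<and>
      (\<forall>(l, s)\<in>set (nodes 0 t). sorted_wrt (<) (List.map_filter root_label (children s)))"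
      using that unfolding all_nodes_ok_def node_ok_def by fast
    moreover have "distinct (even_labels t) \<longleftrightarrow> distinct (labels t)"
      "set (even_labels t) = Some ` label_set t"
      by (simp_all add: even_labels_conv_labels[OF that] distinct_map label_set_conv_labels)
    ultimately show ?thesis
      unfolding increasing_tree_def shape by blast
  qed
  ultimately show ?thesis by blast
qed

section \<open>Label lists of forests\<close>

definition forest_labels :: "nat option otree list \<Rightarrow> nat list" where
  "forest_labels F = concat (map labels F)"

lemma forest_labels_Nil [simp]: "forest_labels [] = []"
  by (simp add: forest_labels_def)

text \<open>\<open>disjoint\<close> sees only a set of label sets, hence the separate condition
  \<open>distinct (map label_set F)\<close>. Since no label set is empty, being disjoint from the
  other label sets implies differing from them.\<close>

lemma disjoint_label_sets_iff:
  assumes "\<forall>t\<in>set F. labels t \<noteq> []"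
  shows "distinct (forest_labels F) \<longleftrightarrow> (\<forall>t\<in>set F. distinct (labels t)) \<and>
    distinct (map label_set F) \<and> disjoint (set (map label_set F))"
  using assms
proof (induction F)
  case Nil
  then show ?case by (simp add: forest_labels_def)
next
  case (Cons t F)
  have notin: "label_set t \<notin> label_set ` set F" if "label_set t \<inter> \<Union> (label_set ` set F) = {}"
  proof -
    have "label_set t \<noteq> {}" using Cons.prems by (simp add: label_set_conv_labels)
    then show ?thesis using that by blast
  qed
  have dist: "distinct (forest_labels (t # F)) \<longleftrightarrow>
      distinct (labels t) \<and> distinct (forest_labels F) \<and> label_set t \<inter> \<Union> (label_set ` set F) = {}"
    by (auto simp: forest_labels_def label_set_conv_labels)
  have disj: "disjoint (insert A \<A>) \<longleftrightarrow> A \<inter> \<Union> \<A> = {} \<and> disjoint \<A>" if "A \<notin> \<A>"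
    for A :: "nat set" and \<A>
  proof -
    have "disjoint (insert A \<A>) \<longleftrightarrow> (\<forall>B\<in>\<A>. A \<inter> B = {}) \<and> disjoint \<A>"
    proof
      assume d: "disjoint (insert A \<A>)"
      have "A \<inter> B = {}" if "B \<in> \<A>" for B
        using disjointD[OF d, of A B] that \<open>A \<notin> \<A>\<close> by auto
      moreover have "disjoint \<A>"
        using disjointD[OF d] by (intro disjointI) simp
      ultimately show "(\<forall>B\<in>\<A>. A \<inter> B = {}) \<and> disjoint \<A>" by blast
    next
      assume *: "(\<forall>B\<in>\<A>. A \<inter> B = {}) \<and> disjoint \<A>"
      show "disjoint (insert A \<A>)"
      proof (rule disjointI)
        fix B C assume "B \<in> insert A \<A>" "C \<in> insert A \<A>" "B \<noteq> C"
        then show "B \<inter> C = {}" using * disjointD[of \<A> B C] by blast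
      qed
    qed
    then show ?thesis by blast
  qed
  have IH: "distinct (forest_labels F) \<longleftrightarrow> (\<forall>t\<in>set F. distinct (labels t)) \<and>
      distinct (map label_set F) \<and> disjoint (label_set ` set F)"
    using Cons by simp
  show ?case
    using notin disj[of "label_set t" "label_set ` set F"]
    by (simp only: dist IH list.set list.map distinct.simps image_insert ball_simps set_map) blast
qed

text \<open>A forest is viewed as the list of children of an unlabeled odd-level node, whose sorting
  condition becomes the order of the root labels.\<close>

lemma all_nodes_ok_forest:
  "all_nodes_ok k (Suc 0) (Node None F) \<longleftrightarrow>
    (\<forall>t\<in>set F. all_nodes_ok k 0 t) \<and> sorted_wrt (<) (List.map_filter root_label F)"
  by (auto simp: all_nodes_ok_Node all_nodes_ok_Suc_Suc node_ok_def)

lemma all_nodes_ok_0_Node_iff: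
  "all_nodes_ok k 0 (Node x cs) \<longleftrightarrow> x \<noteq> None \<and>
    (cs = [] \<or> length cs = k \<and> (\<exists>c\<in>set cs. \<not> is_leaf c)) \<and>
    (\<forall>c\<in>set cs. \<forall>b\<in>set (labels c). the x < b) \<and>
    (\<forall>c\<in>set cs. root_label c = None \<and> all_nodes_ok k (Suc 0) c)" (is "?L \<longleftrightarrow> ?R")
proof -
  have c: "all_nodes_ok k (Suc 0) c \<Longrightarrow> root_label c = None" for c
    by (cases c) (auto simp: all_nodes_ok_Node node_ok_def)
  have "List.map_filter root_label cs = []" if "\<forall>c\<in>set cs. root_label c = None"
    using that by (induction cs) (auto simp: List.map_filter_def)
  then show ?thesis
    using c by (auto simp: all_nodes_ok_Node node_ok_def label_set_conv_labels)
qed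

lemma all_nodes_ok_0_root_label: "all_nodes_ok k 0 t \<Longrightarrow> root_label t \<noteq> None"
  by (cases t) (auto simp: all_nodes_ok_0_Node_iff)

lemma map_filter_root_label:
  "\<forall>t\<in>set F. root_label t \<noteq> None \<Longrightarrow>
    List.map_filter root_label F = map (\<lambda>t. the (root_label t)) F"
  by (induction F) (auto simp: List.map_filter_def)

text \<open>Every tree has a labeled root, so its label set is nonempty and
  \<open>disjoint_label_sets_iff\<close> turns the partition of \<open>M\<close> into statements
  about one list of labels.\<close>

lemma increasing_forests_iff:
  "F \<in> increasing_forests M k \<longleftrightarrow>
    all_nodes_ok k (Suc 0) (Node None F) \<and> distinct (forest_labels F) \<and> set (forest_labels F) = M"
proof (cases "\<forall>t\<in>set F. all_nodes_ok k 0 t")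
  case True
  then have r: "\<forall>t\<in>set F. root_label t \<noteq> None" using all_nodes_ok_0_root_label by blast
  have l: "labels t \<noteq> []" if "t \<in> set F" for t
    using r that by (cases t) auto
  then have "{} \<notin> set (map label_set F)" by (auto simp: label_set_conv_labels)
  moreover have "\<Union> (set (map label_set F)) = set (forest_labels F)"
    by (auto simp: label_set_conv_labels forest_labels_def)
  ultimately show ?thesis
    using True l unfolding increasing_forests_def partition_on_def
    by (auto simp: increasing_tree_iff all_nodes_ok_forest map_filter_root_label[OF r]
        disjoint_label_sets_iff)
next
  case False
  then show ?thesis
    by (auto simp: increasing_forests_def increasing_tree_iff all_nodes_ok_forest)
qed

section \<open>Recursive description of increasing forests\<close>

text \<open>Puts a new first tree with root \<open>r\<close> in front of \<open>G\<close>. The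
  \<open>if\<close> is the pruning: forests that are all empty leave a bare labeled leaf.\<close>

definition graft ::
  "nat \<Rightarrow> nat option otree list list \<Rightarrow> nat option otree list \<Rightarrow> nat option otree list" where
  "graft r Fs G = Node (Some r) (if \<forall>F\<in>set Fs. F = [] then [] else map (Node None) Fs) # G"

lemma graft_neq_Nil [simp]: "graft r Fs G \<noteq> []"
  by (simp add: graft_def)

text \<open>The recursion on forests that matches \<open>interleave\<close> on words. That
  \<open>r\<close> lies below the labels of \<open>G\<close> too reflects that roots increase and
  that each root is the least label of its tree. Distinctness is left to a separate condition on
  \<open>forest_labels\<close>.\<close>

inductive inc_forest :: "nat \<Rightarrow> nat option otree list \<Rightarrow> bool" for k where
  Nil: "inc_forest k []"
| graft: "length Fs = k \<Longrightarrow>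
    \<forall>F\<in>set (G # Fs). inc_forest k F \<and> (\<forall>a\<in>set (forest_labels F). r < a) \<Longrightarrow>
    inc_forest k (graft r Fs G)"

lemma forest_labels_graft:
  "forest_labels (graft r Fs G) = r # concat (map forest_labels Fs) @ forest_labels G"
  by (induction Fs) (auto simp: forest_labels_def graft_def comp_def split: if_splits)

lemma inc_forest_imp_all_nodes_ok:
  "inc_forest k F \<Longrightarrow> all_nodes_ok k (Suc 0) (Node None F)"
proof (induction rule: inc_forest.induct)
  case Nil
  show ?case by (simp add: all_nodes_ok_forest List.map_filter_def)
next
  case (graft Fs G r)
  have "all_nodes_ok k 0 (Node (Some r) (if \<forall>F\<in>set Fs. F = [] then [] else map (Node None) Fs))"
    using graft by (auto simp: all_nodes_ok_0_Node_iff forest_labels_def)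
  moreover have G: "\<forall>t\<in>set G. all_nodes_ok k 0 t" "sorted_wrt (<) (List.map_filter root_label G)"
    using graft by (auto simp: all_nodes_ok_forest)
  moreover have "\<forall>x\<in>set (List.map_filter root_label G). r < x"
  proof
    fix x assume "x \<in> set (List.map_filter root_label G)"
    then obtain t where t: "t \<in> set G" "root_label t = Some x"
      by (auto simp: List.map_filter_def)
    have "x \<in> set (labels t)" using t(2) by (cases t) simp
    then have "x \<in> set (forest_labels G)" using t(1) by (auto simp: forest_labels_def)
    then show "r < x" using graft by simp
  qed
  ultimately show ?case
    by (simp add: all_nodes_ok_forest graft_def List.map_filter_simps)
qed

lemma all_nodes_ok_imp_inc_forest:
  "all_nodes_ok k (Suc 0) (Node None F) \<Longrightarrow> inc_forest k F"
proof (induction "size (Node None F)" arbitrary: F rule: less_induct)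
  case less
  show ?case
  proof (cases F)
    case Nil
    then show ?thesis by (simp add: inc_forest.Nil)
  next
    case (Cons T G)
    obtain x cs where T: "T = Node x cs" by (cases T)
    have ok: "all_nodes_ok k 0 (Node x cs)" "\<forall>t\<in>set G. all_nodes_ok k 0 t"
      and sorted: "sorted_wrt (<) (List.map_filter root_label F)"
      using less.prems Cons T by (auto simp: all_nodes_ok_forest)
    then obtain r where x: "x = Some r" by (auto simp: all_nodes_ok_0_Node_iff)
    \<comment> \<open>A leaf stands for \<open>k\<close> empty forests; otherwise the forests are
      read off the odd-level children.\<close>
    define Fs where "Fs = (if cs = [] then replicate k [] else map children cs)"
    have cs: "cs = [] \<or> length cs = k \<and> (\<exists>c\<in>set cs. \<not> is_leaf c)"
      "\<forall>c\<in>set cs. (\<forall>b\<in>set (labels c). r < b) \<and> root_label c = None \<and> all_nodes_ok k (Suc 0) c"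
      using ok(1) x by (auto simp: all_nodes_ok_0_Node_iff)
    have Node_children: "Node None (children c) = c" if "c \<in> set cs" for c
      using cs(2) that by (cases c) auto
    have "length Fs = k" using cs(1) by (auto simp: Fs_def)
    have F: "F = graft r Fs G"
    proof (cases "cs = []")
      case True
      then show ?thesis by (simp add: Cons T x graft_def Fs_def)
    next
      case False
      then have "map (Node None) Fs = cs" "\<not> (\<forall>F\<in>set Fs. F = [])"
        using Node_children cs(1) by (simp_all add: Fs_def map_idI)
      then show ?thesis by (auto simp: Cons T x graft_def)
    qed
    have labeled: "\<forall>t\<in>set F. root_label t \<noteq> None"
      using less.prems all_nodes_ok_0_root_label by (auto simp: all_nodes_ok_forest)
    have "inc_forest k H \<and> (\<forall>a\<in>set (forest_labels H). r < a)" if H: "H \<in> set Fs" for H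
    proof (cases "cs = []")
      case True
      then have "H = []" using H by (auto simp: Fs_def split: if_splits)
      then show ?thesis by (simp add: inc_forest.Nil forest_labels_def)
    next
      case False
      then obtain c where c: "c \<in> set cs" "H = children c" using H by (auto simp: Fs_def)
      then have eq: "Node None H = c" using Node_children by simp
      have "size c < size (Node None F)"
        using c(1) by (simp add: Cons T) (meson size_list_estimation' le_imp_less_Suc less_SucI
            order_refl trans_le_add1)
      then have "inc_forest k H" using less.hyps[of H] cs(2) c(1) eq by auto
      moreover have "labels c = forest_labels H" by (simp add: forest_labels_def flip: eq)
      ultimately show ?thesis using cs(2) c(1) by auto
    qed
    moreover have "inc_forest k G"
      using less.prems by (intro less.hyps)
        (auto simp: Cons all_nodes_ok_forest List.map_filter_simps split: option.splits)
    moreover have "r < a" if a: "a \<in> set (forest_labels G)" for a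
    proof -
      from a obtain t where t: "t \<in> set G" "a \<in> set (labels t)" by (auto simp: forest_labels_def)
      obtain y ts where y: "t = Node (Some y) ts"
        using t(1) labeled Cons by (metis list.set_intros(2) not_None_eq otree.collapse)
      \<comment> \<open>The label \<open>a\<close> is compared with \<open>r\<close> through the
        root \<open>y\<close> of its tree: roots increase, and \<open>y\<close> is least in its
        tree.\<close>
      have "r < y"
        using sorted t(1) labeled unfolding map_filter_root_label[OF labeled]
        by (auto simp: Cons T x y)
      moreover have "y \<le> a"
        using ok(2) t y by (fastforce simp: all_nodes_ok_0_Node_iff)
      ultimately show ?thesis by simp
    qed
    ultimately show ?thesis unfolding F
      using \<open>length Fs = k\<close> by (intro inc_forest.graft) auto
  qed
qed

lemma increasing_forests_conv_inc_forest:
  "F \<in> increasing_forests M k \<longleftrightarrow>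
    inc_forest k F \<and> distinct (forest_labels F) \<and> set (forest_labels F) = M"
  unfolding increasing_forests_iff
  using inc_forest_imp_all_nodes_ok[of k F] all_nodes_ok_imp_inc_forest[of k F] by blast

text \<open>The forests in \<open>Fs\<close> sit two levels below the root \<open>r\<close>, which
  leaves the parities unchanged; \<open>r\<close> itself is a leaf iff all of them are
  empty.\<close>

lemma lleaf_graft:
  "lleaf (graft r Fs G) = of_bool (\<forall>F\<in>set Fs. F = []) + sum_list (map lleaf Fs) + lleaf G"
proof -
  let ?P = "\<lambda>(l::nat, s::nat option otree). even l \<and> is_leaf s"
  have shift: "length (filter ?P (nodes (Suc (Suc 0)) t)) = lleaf_tree t" for t
    unfolding nodes_Suc_Suc lleaf_tree_def
    by (simp add: filter_map comp_def case_prod_unfold)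
  show ?thesis
  proof (cases "\<forall>F\<in>set Fs. F = []")
    case True
    then have "sum_list (map lleaf Fs) = 0" by (induction Fs) (auto simp: lleaf_def)
    then show ?thesis using True by (simp add: graft_def lleaf_def lleaf_tree_def)
  next
    case False
    then have "lleaf_tree (Node (Some r) (map (Node None) Fs)) = sum_list (map lleaf Fs)"
      unfolding lleaf_tree_def[of "Node (Some r) (map (Node None) Fs)"]
      by (auto simp: filter_concat length_concat comp_def shift lleaf_def[abs_def])
    then show ?thesis using False by (auto simp: graft_def lleaf_def)
  qed
qed

section \<open>The word of a forest\<close>

text \<open>A labeled leaf has lost its \<open>k\<close> children, so the number of copies of its
  label comes from the argument \<open>k\<close>.\<close>

fun word :: "nat \<Rightarrow> nat option otree \<Rightarrow> nat list" where
  "word k (Node None ts) = concat (map (word k) ts)"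
| "word k (Node (Some r) ts) =
    (if ts = [] then replicate k r else concat (map (\<lambda>t. word k t @ [r]) ts))"

definition forest_word :: "nat \<Rightarrow> nat option otree list \<Rightarrow> nat list" where
  "forest_word k F = concat (map (word k) F)"

lemma forest_word_Nil [simp]: "forest_word k [] = []"
  by (simp add: forest_word_def)

text \<open>A leaf root yields \<open>k\<close> copies of \<open>r\<close>, which is the
  interleaving with \<open>k\<close> empty words, so both shapes of a graft give one
  formula.\<close>

lemma forest_word_graft:
  assumes "length Fs = k"
  shows "forest_word k (graft r Fs G) = interleave r (map (forest_word k) Fs) (forest_word k G)"
proof (cases "\<forall>F\<in>set Fs. F = []")
  case True
  then have "interleave r (map (forest_word k) Fs) v = replicate (length Fs) r @ v" for v
    by (induction Fs) auto
  with True assms show ?thesis by (simp add: graft_def forest_word_def)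
next
  case False
  then show ?thesis
    by (auto simp: graft_def forest_word_def interleave_conv_concat comp_def)
qed

lemma mset_interleave:
  "mset (interleave r us v) = replicate_mset (length us) r + (\<Sum>u\<leftarrow>us. mset u) + mset v"
  by (induction us) auto

lemma mset_forest_word:
  assumes "inc_forest k F"
  shows "mset (forest_word k F) = repeat_mset k (mset (forest_labels F))"
  using assms
proof (induction rule: inc_forest.induct)
  case Nil
  show ?case by (simp add: forest_labels_def)
next
  case (graft Fs G r)
  have "(\<Sum>F\<leftarrow>Fs. mset (forest_word k F)) = (\<Sum>F\<leftarrow>Fs. repeat_mset k (mset (forest_labels F)))"
    using graft by (intro arg_cong[where f = sum_list] map_cong) auto
  also have "\<dots> = repeat_mset k (mset (concat (map forest_labels Fs)))"
    by (induction Fs) auto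
  finally show ?case
    using graft by (simp add: forest_word_graft forest_labels_graft mset_interleave comp_def
        repeat_mset_distrib_add_mset)
qed

lemma set_forest_word:
  assumes "k \<ge> 1" "inc_forest k F"
  shows "set (forest_word k F) = set (forest_labels F)"
proof (rule set_eqI)
  fix x
  have "count (mset (forest_word k F)) x = k * count (mset (forest_labels F)) x"
    by (simp add: mset_forest_word[OF assms(2)])
  then show "x \<in> set (forest_word k F) \<longleftrightarrow> x \<in> set (forest_labels F)"
    using assms(1) by (metis count_mset_0_iff mult_eq_0_iff not_one_le_zero)
qed

text \<open>Words repeat their letters, so disjointness of the pieces is expressed through
  repetition-free lists \<open>ls\<close> and \<open>l\<close> with the same letters; in the
  application these are the label lists of the forests.\<close>

lemma stirling_word_interleaveI:
  assumes "\<forall>u\<in>set (v # us). stirling_word u \<and> (\<forall>x\<in>set u. r < x)"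
    and "distinct (concat ls @ l)" "list_all2 (\<lambda>u l. set u = set l) us ls" "set v = set l"
  shows "stirling_word (interleave r us v)"
  using assms(3,1,2,4)
proof (induction us ls rule: list_all2_induct)
  case Nil
  then show ?case by simp
next
  case (Cons u us l' ls)
  have "set (interleave r us v) \<subseteq> insert r (\<Union> (set ` set us) \<union> set v)"
    by (induction us) auto
  moreover have "\<Union> (set ` set us) = \<Union> (set ` set ls)"
    using Cons.hyps(2) by (induction rule: list_all2_induct) auto
  ultimately have sub: "set (interleave r us v) \<subseteq> insert r (set (concat ls) \<union> set l)"
    using Cons.prems by auto
  have "set u \<inter> set (interleave r us v) = {}"
  proof -
    have "r \<notin> set u" "set l' \<inter> (set (concat ls) \<union> set l) = {}" using Cons.prems by auto
    then show ?thesis using sub Cons.hyps(1) by blast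
  qed
  moreover have "\<forall>x\<in>set (interleave r us v). r \<le> x"
    using Cons.prems(1) by (induction us) (auto intro: less_imp_le)
  moreover have "stirling_word (interleave r us v)" using Cons by auto
  ultimately show ?case using Cons.prems by (auto intro!: stirling_word_appendI)
qed

lemma stirling_word_forest_word:
  assumes "k \<ge> 1" "inc_forest k F" "distinct (forest_labels F)"
  shows "stirling_word (forest_word k F)"
  using assms(2,3)
proof (induction rule: inc_forest.induct)
  case Nil
  show ?case by (simp add: stirling_word_def)
next
  case (graft Fs G r)
  have d: "distinct (concat (map forest_labels Fs) @ forest_labels G)"
    using graft.prems by (simp add: forest_labels_graft)
  then have dF: "distinct (forest_labels F)" if "F \<in> set (G # Fs)" for F
    using that by (auto simp: distinct_concat_iff)
  have "stirling_word (interleave r (map (forest_word k) Fs) (forest_word k G))"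
  proof (rule stirling_word_interleaveI[OF _ d])
    show "\<forall>u\<in>set (forest_word k G # map (forest_word k) Fs). stirling_word u \<and> (\<forall>x\<in>set u. r < x)"
      using graft.IH dF by (auto simp: set_forest_word[OF assms(1)])
    show "list_all2 (\<lambda>u l. set u = set l) (map (forest_word k) Fs) (map forest_labels Fs)"
      using graft.IH
      by (auto simp: list.rel_map set_forest_word[OF assms(1)] intro!: list.rel_refl_strong)
    show "set (forest_word k G) = set (forest_labels G)"
      using graft.IH by (simp add: set_forest_word[OF assms(1)])
  qed
  then show ?case using graft.hyps by (simp add: forest_word_graft)
qed

text \<open>\<open>lap_after_interleave\<close> and \<open>lleaf_graft\<close> are the same
  recursion. The letter \<open>p\<close> is arbitrary since it becomes \<open>r\<close> for the
  pieces.\<close>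

lemma lap_after_forest_word:
  assumes "k \<ge> 1" "inc_forest k F" "\<forall>a\<in>set (forest_labels F). p < a"
  shows "lap_after k p (forest_word k F) = lleaf F"
  using assms(2,3)
proof (induction arbitrary: p rule: inc_forest.induct)
  case Nil
  show ?case by (simp add: lleaf_def)
next
  case (graft Fs G r)
  let ?us = "map (forest_word k) Fs"
  have IH: "lap_after k r (forest_word k F) = lleaf F" if "F \<in> set (G # Fs)" for F
    using graft.IH that by blast
  \<comment> \<open>Makes the plateau condition on words coincide with the leaf condition on
    forests.\<close>
  have "forest_word k F = [] \<longleftrightarrow> F = []" if "F \<in> set Fs" for F
  proof -
    have inc: "inc_forest k F" using graft.IH that by simp
    from inc show ?thesis
      using set_forest_word[OF assms(1) inc]
      by (cases rule: inc_forest.cases) (auto simp: forest_labels_graft)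
  qed
  then have empty: "(\<forall>u\<in>set ?us. u = []) \<longleftrightarrow> (\<forall>F\<in>set Fs. F = [])" by auto
  have len: "length ?us = k" using graft.hyps by simp
  have "lap_after k p (interleave r ?us (forest_word k G)) =
    of_bool (\<forall>u\<in>set ?us. u = []) + (\<Sum>u\<leftarrow>?us. lap_after k r u) + lap_after k r (forest_word k G)"
  proof (rule lap_after_interleave[of ?us p r, unfolded len])
    show "?us \<noteq> []" using len assms(1) by auto
    show "p < r" using graft.prems by (simp add: forest_labels_graft)
    show "\<forall>u\<in>set ?us. \<forall>x\<in>set u. r < x"
      using graft.IH by (auto simp: set_forest_word[OF assms(1)])
  qed
  also have "(\<Sum>u\<leftarrow>?us. lap_after k r u) = sum_list (map lleaf Fs)"
    using IH by (simp add: comp_def cong: map_cong)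
  finally show ?case
    using IH graft.hyps by (simp only: forest_word_graft empty lleaf_graft) simp
qed

text \<open>The root \<open>r\<close> is recovered as the least label;
  \<open>interleave_inject\<close> then separates the pieces, and induction applies to each.\<close>

lemma inj_forest_word:
  assumes "k \<ge> 1" "inc_forest k F" "inc_forest k F'" "forest_word k F = forest_word k F'"
  shows "F = F'"
  using assms(2-4)
proof (induction arbitrary: F' rule: inc_forest.induct)
  case Nil
  then have "set (forest_labels F') = {}" using set_forest_word[OF assms(1), of F'] by simp
  with Nil.prems(1) show ?case
    by (cases rule: inc_forest.cases) (auto simp: forest_labels_graft)
next
  case (graft Fs G r)
  note len = graft.hyps and IH = graft.IH and eq = graft.prems(2)
  have inc: "inc_forest k (graft r Fs G)" using len IH by (intro inc_forest.graft) auto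
  have labels: "set (forest_labels (graft r Fs G)) = set (forest_labels F')"
    using set_forest_word[OF assms(1)] inc graft.prems by metis
  from graft.prems(1) show ?case
  proof (cases rule: inc_forest.cases)
    case Nil
    then show ?thesis using labels by (simp add: forest_labels_graft)
  next
    case (graft Fs' G' r')
    have "Min (set (forest_labels (graft r Fs G))) = r"
      using IH by (intro Min_eqI) (auto simp: forest_labels_graft intro: less_imp_le)
    moreover have "Min (set (forest_labels F')) = r'"
      using graft by (intro Min_eqI) (auto simp: forest_labels_graft intro: less_imp_le)
    ultimately have "r' = r" using labels by simp
    have notin: "\<forall>H\<in>set Fs. r \<notin> set (forest_word k H)" "\<forall>H\<in>set Fs'. r \<notin> set (forest_word k H)"
      using \<open>r' = r\<close> IH graft(3) by (auto simp: set_forest_word[OF assms(1)])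
    have "map (forest_word k) Fs = map (forest_word k) Fs' \<and> forest_word k G = forest_word k G'"
    proof (rule interleave_inject)
      show "interleave r (map (forest_word k) Fs) (forest_word k G) =
          interleave r (map (forest_word k) Fs') (forest_word k G')"
        using eq len graft(1,2) \<open>r' = r\<close> by (simp add: forest_word_graft)
    qed (use len graft(2) notin in auto)
    then have words: "list_all2 (\<lambda>F F'. forest_word k F = forest_word k F') Fs Fs'"
      "forest_word k G = forest_word k G'"
      by (auto simp: list.rel_eq[symmetric] list.rel_map)
    have "G = G'" using IH graft(3) words(2) by auto
    moreover have "Fs = Fs'"
    proof (rule nth_equalityI)
      show "length Fs = length Fs'" using len graft(2) by simp
      fix i assume i: "i < length Fs"
      then have "Fs ! i \<in> set Fs" "Fs' ! i \<in> set Fs'" using len graft(2) by auto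
      then show "Fs ! i = Fs' ! i"
        using IH graft(3) list_all2_nthD[OF words(1) i] by auto
    qed
    ultimately show ?thesis using graft(1) \<open>r' = r\<close> by simp
  qed
qed

lemma ex_forest_word:
  assumes "k \<ge> 1" "stirling_word w" "\<forall>x\<in>set w. count (mset w) x = k"
  shows "\<exists>F. inc_forest k F \<and> forest_word k F = w"
  using assms(2,3)
proof (induction "length w" arbitrary: w rule: less_induct)
  case less
  show ?case
  proof (cases "w = []")
    case True
    then show ?thesis by (auto intro!: exI[of _ "[]"] inc_forest.Nil)
  next
    case False
    \<comment> \<open>In a graft the first root lies below all other labels, so only the least
      letter of \<open>w\<close> can serve.\<close>
    define r where "r = Min (set w)"
    have r: "r \<in> set w" "\<And>x. x \<in> set w \<Longrightarrow> r \<le> x"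
      using False by (auto simp: r_def)
    then have "count (mset w) r = k" using less.prems(2) by blast
    from interleave_split[OF this] obtain us v
      where us: "length us = k" "w = interleave r us v" "\<forall>u\<in>set (v # us). r \<notin> set u" by blast
    have sub: "set u \<subseteq> set w" "length u < length w" if "u \<in> set (v # us)" for u
    proof -
      have "us \<noteq> []" using us(1) assms(1) by auto
      then show "length u < length w" using that us(2) length_interleave_less by blast
      show "set u \<subseteq> set w" using that by (auto simp: us(2) interleave_conv_concat)
    qed
    have gt: "\<forall>u\<in>set (v # us). \<forall>x\<in>set u. r < x"
      using sub(1) r(2) us(3) by (metis nless_le subsetD)
    have pieces: "\<forall>u\<in>set (v # us). stirling_word u \<and> (\<forall>x\<in>set u. count (mset u) x = k)"
      using less.prems us(2) gt by (intro stirling_word_interleaveD[of r us v]) auto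
    have "\<forall>u\<in>set (v # us). \<exists>F. inc_forest k F \<and> forest_word k F = u"
      using less.hyps sub(2) pieces by blast
    then obtain f where f: "\<forall>u\<in>set (v # us). inc_forest k (f u) \<and> forest_word k (f u) = u"
      by metis
    have "inc_forest k (graft r (map f us) (f v))"
    proof (rule inc_forest.graft)
      show "\<forall>F\<in>set (f v # map f us). inc_forest k F \<and> (\<forall>a\<in>set (forest_labels F). r < a)"
        using f gt by (auto simp: set_forest_word[OF assms(1), symmetric])
    qed (use us in simp)
    moreover have "forest_word k (graft r (map f us) (f v)) = w"
      using f us by (simp add: forest_word_graft comp_def map_idI)
    ultimately show ?thesis by blast
  qed
qed

lemma count_forest_word:
  assumes "k \<ge> 1" "inc_forest k F" "distinct (forest_labels F)" "x \<in> set (forest_word k F)"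
  shows "count (mset (forest_word k F)) x = k"
  using assms by (auto simp: mset_forest_word set_forest_word distinct_count_atmost_1)

lemma bij_betw_forest_word:
  assumes "k \<ge> 1" "finite M"
  shows "bij_betw (forest_word k) (increasing_forests M k) (stirling_perms M k)"
proof (rule bij_betwI')
  fix F F' assume "F \<in> increasing_forests M k" "F' \<in> increasing_forests M k"
  then show "forest_word k F = forest_word k F' \<longleftrightarrow> F = F'"
    using inj_forest_word[OF assms(1)] by (auto simp: increasing_forests_conv_inc_forest)
next
  fix F assume "F \<in> increasing_forests M k"
  then show "forest_word k F \<in> stirling_perms M k"
    using set_forest_word[OF assms(1)] stirling_word_forest_word[OF assms(1)] count_forest_word[OF assms(1)]
    by (auto simp: increasing_forests_conv_inc_forest stirling_perms_iff[OF assms])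
next
  fix w assume "w \<in> stirling_perms M k"
  then have w: "stirling_word w" "\<forall>x\<in>set w. count (mset w) x = k" "set w = M"
    by (auto simp: stirling_perms_iff[OF assms])
  from ex_forest_word[OF assms(1) w(1,2)] obtain F
    where F: "inc_forest k F" "w = forest_word k F" by blast
  \<comment> \<open>\<open>inc_forest\<close> allows repeated labels. A letter occurs
    \<open>k\<close> times in \<open>w\<close>, which is \<open>k\<close> times its multiplicity in
    the label list, so that multiplicity is 1.\<close>
  have "count (mset (forest_labels F)) x = of_bool (x \<in> set (forest_labels F))" for x
  proof (cases "x \<in> set (forest_labels F)")
    case True
    then have "k * count (mset (forest_labels F)) x = k"
      using w(2) F set_forest_word[OF assms(1) F(1)] mset_forest_word[OF F(1)] by auto
    then show ?thesis using True assms(1) by simp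
  qed simp
  then have "distinct (forest_labels F)" by (simp add: distinct_count_atmost_1)
  then show "\<exists>F\<in>increasing_forests M k. w = forest_word k F"
    using F w(3) set_forest_word[OF assms(1) F(1)]
    by (auto simp: increasing_forests_conv_inc_forest)
qed

theorem proposition3p1:
  fixes k :: nat and M :: "nat set"
  assumes "k \<ge> 1" and "finite M" and "\<forall>a\<in>M. a > 0"
  shows "\<exists>\<xi>. bij_betw \<xi> (stirling_perms M k) (increasing_forests M k) \<and>
           (\<forall>\<pi>\<in>stirling_perms M k. lap k \<pi> = lleaf (\<xi> \<pi>))"
proof -
  let ?f = "forest_word k" and ?\<F> = "increasing_forests M k"
  have bij: "bij_betw ?f ?\<F> (stirling_perms M k)"
    using assms by (intro bij_betw_forest_word)
  have "lap k \<pi> = lleaf (inv_into ?\<F> ?f \<pi>)" if \<pi>: "\<pi> \<in> stirling_perms M k" for \<pi>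
  proof -
    define F where "F = inv_into ?\<F> ?f \<pi>"
    have "F \<in> ?\<F>" "?f F = \<pi>"
      using bij \<pi> by (auto simp: F_def bij_betw_def inv_into_into f_inv_into_f)
    \<comment> \<open>The value 0 of \<open>p\<close> is the letter prepended in \<open>lap\<close>;
      it lies below all labels because \<open>M\<close> consists of positive numbers.\<close>
    then have "lap_after k 0 \<pi> = lleaf F"
      using lap_after_forest_word[OF assms(1), of F 0] assms(3)
      by (auto simp: increasing_forests_conv_inc_forest)
    then show ?thesis using lap_conv_lap_after[OF assms(1)] by (simp add: F_def)
  qed
  then show ?thesis using bij_betw_inv_into[OF bij] by blast
qed

end
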